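(* Let $E(H,K)\equiv e\to H\xrightarrow{i} G\xrightarrow{\beta} K\to e$ be a split center extension of multiplicative Lie algebras. Then every compatible pair $(\alpha,\eta)\in\mathrm{Aut}(H)\times\mathrm{Aut}(K)$ is inducible.
   Context: A multiplicative Lie algebra is a triple $(G,\cdot,\star)$ where $(G,\cdot)$ is a (possibly non-abelian) group with identity $e$ and $\star$ is a binary operation such that for all $x,y,z\in G$, writing ${}^zx=zxz^{-1}$: $x\star x=e$; $x\star(yz)=(x\star y)\cdot{}^y(x\star z)$; $(xy)\star z={}^x(y\star z)\cdot(x\star z)$; $((x\star y)\star{}^yz)((y\star z)\star{}^zx)((z\star x)\star{}^xy)=e$; ${}^z(x\star y)={}^zx\star{}^zy$. Homomorphisms preserve both operations, and $\mathrm{Aut}$ denotes the group of automorphisms of a multiplicative Lie algebra. A center extension $E(H,K)\equiv e\to H\xrightarrow{i} G\xrightarrow{\beta}K\to e$ is a short exact sequence of multiplicative Lie algebras in which $H$ (identified with $i(H)=\ker\beta$) is contained in the group center $Z(G)$ and $a\star b=e$ for all $a,b\in H$. $H$ is an ideal of $G$, so $g\star a\in H$ for $g\in G$, $a\in H$. A transversal is a map $t:K\to G$ with $\beta(t(x))=x$ for all $x\in K$ and $t(e)=e$. The extension splits if there is a transversal $t:K\to G$ that is a homomorphism of multiplicative Lie algebras. For $x\in K$, $\Gamma_x\in\mathrm{End}(H)$ is $\Gamma_x(a)=t(x)\star a$ (independent of the transversal $t$). A pair $(\alpha,\eta)\in\mathrm{Aut}(H)\times\mathrm{Aut}(K)$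 is compatible if $\alpha\Gamma_x\alpha^{-1}=\Gamma_{\eta(x)}$ for all $x\in K$. It is inducible if there is $\phi\in\mathrm{Aut}(G)$ with $\phi(H)=H$, $\phi|_H=\alpha$ and $\beta(\phi(t(x)))=\eta(x)$ for all $x\in K$ (independent of $t$). *)

theory Defs
  imports "HOL-Algebra.Coset" "HOL-Algebra.Bij"
begin

record 'a mult_lie = "'a monoid" +
  lstar :: "'a \<Rightarrow> 'a \<Rightarrow> 'a"  (infixl \<open>\<star>\<index>\<close> 70)

text \<open>The left conjugate of x by z, written with z as a superscript on the left of x.\<close>

definition conjugate :: "('a, 'm) monoid_scheme \<Rightarrow> 'a \<Rightarrow> 'a \<Rightarrow> 'a" where
  "conjugate G z x = z \<otimes>\<^bsub>G\<^esub> x \<otimes>\<^bsub>G\<^esub> inv\<^bsub>G\<^esub> z"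

locale mult_lie_algebra = group G for G (structure) +
  assumes star_closed: "\<lbrakk>x \<in> carrier G; y \<in> carrier G\<rbrakk> \<Longrightarrow> x \<star> y \<in> carrier G"
    and star_self: "x \<in> carrier G \<Longrightarrow> x \<star> x = \<one>"
    and star_mult_right: "\<lbrakk>x \<in> carrier G; y \<in> carrier G; z \<in> carrier G\<rbrakk> \<Longrightarrow>
      x \<star> (y \<otimes> z) = (x \<star> y) \<otimes> conjugate G y (x \<star> z)"
    and star_mult_left: "\<lbrakk>x \<in> carrier G; y \<in> carrier G; z \<in> carrier G\<rbrakk> \<Longrightarrow>
      (x \<otimes> y) \<star> z = conjugate G x (y \<star> z) \<otimes> (x \<star> z)"
    and star_jacobi: "\<lbrakk>x \<in> carrier G; y \<in> carrier G; z \<in> carrier G\<rbrakk> \<Longrightarrow>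
      ((x \<star> y) \<star> conjugate G y z) \<otimes> ((y \<star> z) \<star> conjugate G z x)
        \<otimes> ((z \<star> x) \<star> conjugate G x y) = \<one>"
    and conjugate_star: "\<lbrakk>x \<in> carrier G; y \<in> carrier G; z \<in> carrier G\<rbrakk> \<Longrightarrow>
      conjugate G z (x \<star> y) = conjugate G z x \<star> conjugate G z y"

definition mult_lie_hom ::
    "('a, 'm) mult_lie_scheme \<Rightarrow> ('b, 'n) mult_lie_scheme \<Rightarrow> ('a \<Rightarrow> 'b) set" where
  "mult_lie_hom G H = {f \<in> hom G H.
     \<forall>x \<in> carrier G. \<forall>y \<in> carrier G. f (x \<star>\<^bsub>G\<^esub> y) = f x \<star>\<^bsub>H\<^esub> f y}"

text \<open>As for \<^const>\<open>auto\<close>, automorphisms are extensional functions on the carrier.\<close>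

definition mult_lie_auto :: "('a, 'm) mult_lie_scheme \<Rightarrow> ('a \<Rightarrow> 'a) set" where
  "mult_lie_auto G = mult_lie_hom G G \<inter> auto G"

definition group_center :: "('a, 'm) monoid_scheme \<Rightarrow> 'a set" where
  "group_center G = {z \<in> carrier G. \<forall>g \<in> carrier G. z \<otimes>\<^bsub>G\<^esub> g = g \<otimes>\<^bsub>G\<^esub> z}"

text \<open>The inclusion i is kept explicit: H is identified with its image, the kernel of \<open>\<beta>\<close>.\<close>

locale center_extension =
  H: mult_lie_algebra H + G: mult_lie_algebra G + K: mult_lie_algebra K
  for H (structure) and G (structure) and K (structure) +
  fixes i and \<beta>
  assumes i_hom: "i \<in> mult_lie_hom H G"
    and \<beta>_hom: "\<beta> \<in> mult_lie_hom G K"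
    and i_inj: "inj_on i (carrier H)"
    and exact: "i ` carrier H = kernel G K \<beta>"
    and \<beta>_surj: "\<beta> ` carrier G = carrier K"
    and central: "i ` carrier H \<subseteq> group_center G"
    and star_trivial: "\<lbrakk>a \<in> carrier H; b \<in> carrier H\<rbrakk> \<Longrightarrow> i a \<star>\<^bsub>G\<^esub> i b = \<one>\<^bsub>G\<^esub>"

definition transversal ::
    "('g, 'm) monoid_scheme \<Rightarrow> ('k, 'n) monoid_scheme \<Rightarrow> ('g \<Rightarrow> 'k) \<Rightarrow> ('k \<Rightarrow> 'g) \<Rightarrow> bool" where
  "transversal G K \<beta> t \<longleftrightarrow>
     t \<in> carrier K \<rightarrow> carrier G \<and> (\<forall>x \<in> carrier K. \<beta> (t x) = x) \<and> t \<one>\<^bsub>K\<^esub> = \<one>\<^bsub>G\<^esub>"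

definition splits ::
    "('g, 'm) mult_lie_scheme \<Rightarrow> ('k, 'n) mult_lie_scheme \<Rightarrow> ('g \<Rightarrow> 'k) \<Rightarrow> bool" where
  "splits G K \<beta> \<longleftrightarrow> (\<exists>t. transversal G K \<beta> t \<and> t \<in> mult_lie_hom K G)"

text \<open>The star product of t x with an element of H, pulled back to H along i.\<close>

definition Gamma ::
    "('h, 'l) mult_lie_scheme \<Rightarrow> ('g, 'm) mult_lie_scheme \<Rightarrow> ('h \<Rightarrow> 'g) \<Rightarrow> ('k \<Rightarrow> 'g)
      \<Rightarrow> 'k \<Rightarrow> 'h \<Rightarrow> 'h" where
  "Gamma H G i t x a = the_inv_into (carrier H) i (t x \<star>\<^bsub>G\<^esub> i a)"

definition compatible ::
    "('h, 'l) mult_lie_scheme \<Rightarrow> ('g, 'm) mult_lie_scheme \<Rightarrow> ('k, 'n) mult_lie_scheme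
      \<Rightarrow> ('h \<Rightarrow> 'g) \<Rightarrow> ('k \<Rightarrow> 'g) \<Rightarrow> ('h \<Rightarrow> 'h) \<Rightarrow> ('k \<Rightarrow> 'k) \<Rightarrow> bool" where
  "compatible H G K i t \<alpha> \<eta> \<longleftrightarrow>
     (\<forall>x \<in> carrier K. \<forall>a \<in> carrier H.
        \<alpha> (Gamma H G i t x (the_inv_into (carrier H) \<alpha> a)) = Gamma H G i t (\<eta> x) a)"

definition inducible ::
    "('h, 'l) mult_lie_scheme \<Rightarrow> ('g, 'm) mult_lie_scheme \<Rightarrow> ('k, 'n) mult_lie_scheme
      \<Rightarrow> ('h \<Rightarrow> 'g) \<Rightarrow> ('g \<Rightarrow> 'k) \<Rightarrow> ('k \<Rightarrow> 'g) \<Rightarrow> ('h \<Rightarrow> 'h) \<Rightarrow> ('k \<Rightarrow> 'k) \<Rightarrow> bool" where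
  "inducible H G K i \<beta> t \<alpha> \<eta> \<longleftrightarrow>
     (\<exists>\<phi> \<in> mult_lie_auto G.
        \<phi> ` (i ` carrier H) = i ` carrier H
        \<and> (\<forall>a \<in> carrier H. \<phi> (i a) = i (\<alpha> a))
        \<and> (\<forall>x \<in> carrier K. \<beta> (\<phi> (t x)) = \<eta> x))"

text \<open>The definitions of \<^const>\<open>Gamma\<close>, \<^const>\<open>compatible\<close> and \<^const>\<open>inducible\<close>
  mention a transversal; the lemmas below show that they do not depend on it.\<close>

context mult_lie_algebra
begin

lemma star_one_right: assumes "x \<in> carrier G" shows "x \<star> \<one> = \<one>"
proof -
  have c: "x \<star> \<one> \<in> carrier G" using assms by (simp add: star_closed)
  have "x \<star> \<one> = (x \<star> \<one>) \<otimes> (x \<star> \<one>)"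
    using star_mult_right[OF assms one_closed one_closed] c by (simp add: conjugate_def)
  thus ?thesis using c by simp
qed

end

context center_extension
begin

lemma i_closed: "a \<in> carrier H \<Longrightarrow> i a \<in> carrier G"
  using i_hom by (auto simp: mult_lie_hom_def hom_def)

lemma \<beta>_closed: "g \<in> carrier G \<Longrightarrow> \<beta> g \<in> carrier K"
  using \<beta>_hom by (auto simp: mult_lie_hom_def hom_def)

lemma i_central: "\<lbrakk>a \<in> carrier H; g \<in> carrier G\<rbrakk> \<Longrightarrow> i a \<otimes>\<^bsub>G\<^esub> g = g \<otimes>\<^bsub>G\<^esub> i a"
  using central by (auto simp: group_center_def)

lemma \<beta>_i: "a \<in> carrier H \<Longrightarrow> \<beta> (i a) = \<one>\<^bsub>K\<^esub>"
  using exact by (auto simp: kernel_def)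

lemma star_i_in_image:
  assumes "g \<in> carrier G" "a \<in> carrier H"
  shows "g \<star>\<^bsub>G\<^esub> i a \<in> i ` carrier H"
proof -
  have "\<beta> (g \<star>\<^bsub>G\<^esub> i a) = \<beta> g \<star>\<^bsub>K\<^esub> \<beta> (i a)"
    using \<beta>_hom assms i_closed by (auto simp: mult_lie_hom_def)
  also have "\<dots> = \<one>\<^bsub>K\<^esub>"
    using assms by (simp add: \<beta>_i \<beta>_closed K.star_one_right)
  finally show ?thesis
    using assms by (simp add: exact kernel_def G.star_closed i_closed)
qed

lemma i_Gamma:
  assumes "transversal G K \<beta> t" "x \<in> carrier K" "a \<in> carrier H"
  shows "Gamma H G i t x a \<in> carrier H" "i (Gamma H G i t x a) = t x \<star>\<^bsub>G\<^esub> i a"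
proof -
  have "t x \<star>\<^bsub>G\<^esub> i a \<in> i ` carrier H"
    using assms by (intro star_i_in_image) (auto simp: transversal_def)
  thus "Gamma H G i t x a \<in> carrier H" "i (Gamma H G i t x a) = t x \<star>\<^bsub>G\<^esub> i a"
    unfolding Gamma_def using i_inj
    by (auto intro: the_inv_into_into f_the_inv_into_f)
qed

lemma transversal_differ:
  assumes "transversal G K \<beta> s" "transversal G K \<beta> t" "x \<in> carrier K"
  obtains h where "h \<in> carrier H" "t x = s x \<otimes>\<^bsub>G\<^esub> i h"
proof -
  interpret b: group_hom G K \<beta>
    using \<beta>_hom by unfold_locales (simp add: mult_lie_hom_def)
  have c: "s x \<in> carrier G" "t x \<in> carrier G" and "\<beta> (s x) = x" "\<beta> (t x) = x"
    using assms by (auto simp: transversal_def)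
  hence "inv\<^bsub>G\<^esub> (s x) \<otimes>\<^bsub>G\<^esub> t x \<in> kernel G K \<beta>"
    using assms(3) by (simp add: kernel_def)
  then obtain h where "h \<in> carrier H" "inv\<^bsub>G\<^esub> (s x) \<otimes>\<^bsub>G\<^esub> t x = i h"
    unfolding exact[symmetric] by auto
  moreover have "t x = s x \<otimes>\<^bsub>G\<^esub> (inv\<^bsub>G\<^esub> (s x) \<otimes>\<^bsub>G\<^esub> t x)"
    using c by (simp add: G.m_assoc[symmetric])
  ultimately show ?thesis using that by metis
qed

lemma Gamma_independent:
  assumes s: "transversal G K \<beta> s" and t: "transversal G K \<beta> t"
    and x: "x \<in> carrier K" and a: "a \<in> carrier H"
  shows "Gamma H G i t x a = Gamma H G i s x a"
proof -
  obtain h where h: "h \<in> carrier H" "t x = s x \<otimes>\<^bsub>G\<^esub> i h"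
    using transversal_differ[OF s t x] .
  have c: "s x \<in> carrier G" using s x by (auto simp: transversal_def)
  have "t x \<star>\<^bsub>G\<^esub> i a = s x \<star>\<^bsub>G\<^esub> i a"
    using h a c
    by (simp add: G.star_mult_left i_closed star_trivial conjugate_def G.star_closed)
  thus ?thesis by (simp add: Gamma_def)
qed

lemma Gamma_End:
  assumes t: "transversal G K \<beta> t" and x: "x \<in> carrier K"
  shows "Gamma H G i t x \<in> mult_lie_hom H H"
proof -
  interpret i: group_hom H G i
    using i_hom by unfold_locales (simp add: mult_lie_hom_def)
  have tx: "t x \<in> carrier G" using t x by (auto simp: transversal_def)
  note cl = i_Gamma(1)[OF t x] and ev = i_Gamma(2)[OF t x]
  have ab: "a \<star>\<^bsub>H\<^esub> b = \<one>\<^bsub>H\<^esub>" if "a \<in> carrier H" "b \<in> carrier H" for a b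
  proof -
    have "i (a \<star>\<^bsub>H\<^esub> b) = i \<one>\<^bsub>H\<^esub>"
      using i_hom that by (simp add: mult_lie_hom_def star_trivial)
    thus ?thesis using that by (intro inj_onD[OF i_inj]) (auto simp: H.star_closed)
  qed
  have "Gamma H G i t x (a \<otimes>\<^bsub>H\<^esub> b) = Gamma H G i t x a \<otimes>\<^bsub>H\<^esub> Gamma H G i t x b"
    if a: "a \<in> carrier H" and b: "b \<in> carrier H" for a b
  proof -
    have sc: "t x \<star>\<^bsub>G\<^esub> i b \<in> carrier G" using tx b by (simp add: G.star_closed i_closed)
    have "conjugate G (i a) (t x \<star>\<^bsub>G\<^esub> i b) = t x \<star>\<^bsub>G\<^esub> i b"
      using a sc by (simp add: conjugate_def i_central i_closed G.m_assoc)
    hence "i (Gamma H G i t x (a \<otimes>\<^bsub>H\<^esub> b)) = i (Gamma H G i t x a \<otimes>\<^bsub>H\<^esub> Gamma H G i t x b)"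
      using a b tx by (simp add: ev cl G.star_mult_right i_closed)
    thus ?thesis using a b cl by (intro inj_onD[OF i_inj]) auto
  qed
  moreover have "Gamma H G i t x \<one>\<^bsub>H\<^esub> = \<one>\<^bsub>H\<^esub>"
  proof -
    have "i (Gamma H G i t x \<one>\<^bsub>H\<^esub>) = i \<one>\<^bsub>H\<^esub>"
      using tx by (simp add: ev G.star_one_right)
    thus ?thesis using cl by (intro inj_onD[OF i_inj]) auto
  qed
  ultimately show ?thesis
    using cl by (auto simp: mult_lie_hom_def hom_def ab)
qed

lemma compatible_independent:
  assumes s: "transversal G K \<beta> s" and t: "transversal G K \<beta> t"
    and \<alpha>: "\<alpha> \<in> mult_lie_auto H" and \<eta>: "\<eta> \<in> mult_lie_auto K"
  shows "compatible H G K i t \<alpha> \<eta> \<longleftrightarrow> compatible H G K i s \<alpha> \<eta>"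
proof -
  have "bij_betw \<alpha> (carrier H) (carrier H)"
    using \<alpha> by (simp add: mult_lie_auto_def auto_def Bij_def)
  hence "the_inv_into (carrier H) \<alpha> a \<in> carrier H" if "a \<in> carrier H" for a
    using that by (auto simp: bij_betw_def intro: the_inv_into_into)
  moreover have "\<eta> x \<in> carrier K" if "x \<in> carrier K" for x
    using \<eta> that by (auto simp: mult_lie_auto_def mult_lie_hom_def hom_def)
  ultimately show ?thesis
    by (simp add: compatible_def Gamma_independent[OF s t])
qed

lemma inducible_independent:
  assumes s: "transversal G K \<beta> s" and t: "transversal G K \<beta> t"
    and \<alpha>: "\<alpha> \<in> mult_lie_auto H"
  shows "inducible H G K i \<beta> t \<alpha> \<eta> \<longleftrightarrow> inducible H G K i \<beta> s \<alpha> \<eta>"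
proof -
  have "\<beta> (\<phi> (t x)) = \<beta> (\<phi> (s x))"
    if \<phi>: "\<phi> \<in> mult_lie_auto G" "\<forall>a \<in> carrier H. \<phi> (i a) = i (\<alpha> a)" and x: "x \<in> carrier K"
    for \<phi> x
  proof -
    obtain h where h: "h \<in> carrier H" "t x = s x \<otimes>\<^bsub>G\<^esub> i h"
      using transversal_differ[OF s t x] .
    have c: "s x \<in> carrier G" using s x by (auto simp: transversal_def)
    have \<alpha>h: "\<alpha> h \<in> carrier H"
      using \<alpha> h by (auto simp: mult_lie_auto_def mult_lie_hom_def hom_def)
    have \<phi>c: "\<phi> (s x) \<in> carrier G"
      using \<phi> c by (auto simp: mult_lie_auto_def mult_lie_hom_def hom_def)
    have "\<phi> (t x) = \<phi> (s x) \<otimes>\<^bsub>G\<^esub> i (\<alpha> h)"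
      using \<phi> h c i_closed by (simp add: mult_lie_auto_def mult_lie_hom_def hom_def)
    moreover have "\<beta> (\<phi> (s x) \<otimes>\<^bsub>G\<^esub> i (\<alpha> h)) = \<beta> (\<phi> (s x)) \<otimes>\<^bsub>K\<^esub> \<beta> (i (\<alpha> h))"
      using \<beta>_hom \<phi>c \<alpha>h i_closed by (simp add: mult_lie_hom_def hom_def)
    ultimately show ?thesis
      using \<alpha>h \<phi>c by (simp add: \<beta>_i \<beta>_closed)
  qed
  thus ?thesis unfolding inducible_def by (intro bex_cong refl) auto
qed

end

end

theory Submission
  imports Defs
begin

text \<open>
  Fix a section \<open>s\<close> of \<open>\<beta>\<close> that is a homomorphism. Every element of \<open>G\<close> is \<open>i a \<otimes> s x\<close> for
  exactly one pair \<open>(a, x)\<close>, and in these coordinates both operations of \<open>G\<close> are determined by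
  \<open>H\<close>, \<open>K\<close> and \<open>\<Gamma>\<close> alone. Since \<open>i a\<close> is central and \<open>s\<close> is multiplicative, the product is taken
  componentwise. Since stars inside \<open>H\<close> vanish and \<open>s\<close> preserves \<open>\<star>\<close>,
  the star of \<open>i a \<otimes> s x\<close> with \<open>i b \<otimes> s y\<close> has coordinates \<open>(\<Gamma> x b \<otimes> inv \<Gamma> y a, x \<star> y)\<close>.
  So the map sending \<open>(a, x)\<close> to \<open>(\<alpha> a, \<eta> x)\<close> always respects products, and it respects stars as
  soon as \<open>\<alpha> \<circ> \<Gamma> x = \<Gamma> (\<eta> x) \<circ> \<alpha>\<close>, which is compatibility. This is the automorphism
  that induces the pair \<open>(\<alpha>, \<eta>)\<close>. The two formulas are \<open>glue_mult\<close> and \<open>glue_star\<close> below.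
\<close>

lemma mult_lie_auto_closed: "\<lbrakk>f \<in> mult_lie_auto G; x \<in> carrier G\<rbrakk> \<Longrightarrow> f x \<in> carrier G"
  by (auto simp: mult_lie_auto_def mult_lie_hom_def hom_def)

lemma mult_lie_auto_mult:
  "\<lbrakk>f \<in> mult_lie_auto G; x \<in> carrier G; y \<in> carrier G\<rbrakk> \<Longrightarrow> f (x \<otimes>\<^bsub>G\<^esub> y) = f x \<otimes>\<^bsub>G\<^esub> f y"
  by (auto simp: mult_lie_auto_def mult_lie_hom_def hom_def)

lemma mult_lie_auto_star:
  "\<lbrakk>f \<in> mult_lie_auto G; x \<in> carrier G; y \<in> carrier G\<rbrakk> \<Longrightarrow> f (x \<star>\<^bsub>G\<^esub> y) = f x \<star>\<^bsub>G\<^esub> f y"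
  by (auto simp: mult_lie_auto_def mult_lie_hom_def)

lemma mult_lie_auto_bij: "f \<in> mult_lie_auto G \<Longrightarrow> bij_betw f (carrier G) (carrier G)"
  by (simp add: mult_lie_auto_def auto_def Bij_def)

context center_extension
begin

lemma conjugate_by_i: "\<lbrakk>a \<in> carrier H; g \<in> carrier G\<rbrakk> \<Longrightarrow> conjugate G (i a) g = g"
  by (simp add: conjugate_def i_central i_closed G.m_assoc)

text \<open>Expanding the trivial star of \<open>i a \<otimes> g\<close> with itself leaves only the two mixed terms, because
  conjugation by the central \<open>i a\<close> is trivial.\<close>

lemma i_star:
  assumes a: "a \<in> carrier H" and g: "g \<in> carrier G"
  shows "i a \<star>\<^bsub>G\<^esub> g = inv\<^bsub>G\<^esub> (g \<star>\<^bsub>G\<^esub> i a)"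
proof -
  have "(i a \<otimes>\<^bsub>G\<^esub> g) \<star>\<^bsub>G\<^esub> (i a \<otimes>\<^bsub>G\<^esub> g) = (g \<star>\<^bsub>G\<^esub> i a) \<otimes>\<^bsub>G\<^esub> (i a \<star>\<^bsub>G\<^esub> g)"
    using a g by (simp add: G.star_mult_left G.star_mult_right star_trivial
        conjugate_by_i i_closed G.star_closed G.star_self[OF g])
  hence "(g \<star>\<^bsub>G\<^esub> i a) \<otimes>\<^bsub>G\<^esub> (i a \<star>\<^bsub>G\<^esub> g) = \<one>\<^bsub>G\<^esub>"
    using a g by (simp add: G.star_self i_closed)
  thus ?thesis
    using a g by (metis G.inv_comm G.inv_equality G.star_closed i_closed)
qed

end

locale split_center_extension = center_extension H G K i \<beta>
  for H (structure) and G (structure) and K (structure) and i and \<beta> +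
  fixes s
  assumes s_transversal: "transversal G K \<beta> s"
    and s_hom: "s \<in> mult_lie_hom K G"
begin

lemma s_closed: "x \<in> carrier K \<Longrightarrow> s x \<in> carrier G"
  and \<beta>_s: "x \<in> carrier K \<Longrightarrow> \<beta> (s x) = x"
  and s_one: "s \<one>\<^bsub>K\<^esub> = \<one>\<^bsub>G\<^esub>"
  using s_transversal by (auto simp: transversal_def)

lemma s_mult: "\<lbrakk>x \<in> carrier K; y \<in> carrier K\<rbrakk> \<Longrightarrow> s (x \<otimes>\<^bsub>K\<^esub> y) = s x \<otimes>\<^bsub>G\<^esub> s y"
  and s_star: "\<lbrakk>x \<in> carrier K; y \<in> carrier K\<rbrakk> \<Longrightarrow> s (x \<star>\<^bsub>K\<^esub> y) = s x \<star>\<^bsub>G\<^esub> s y"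
  using s_hom by (auto simp: mult_lie_hom_def hom_def)

sublocale i: group_hom H G i
  using i_hom by unfold_locales (simp add: mult_lie_hom_def)

sublocale b: group_hom G K \<beta>
  using \<beta>_hom by unfold_locales (simp add: mult_lie_hom_def)

abbreviation \<Gamma> where "\<Gamma> \<equiv> Gamma H G i s"

lemmas \<Gamma>_closed = i_Gamma(1)[OF s_transversal]
  and i_\<Gamma> = i_Gamma(2)[OF s_transversal]

definition glue where "glue = (\<lambda>(a, x). i a \<otimes>\<^bsub>G\<^esub> s x)"

lemma \<beta>_glue: "\<lbrakk>a \<in> carrier H; x \<in> carrier K\<rbrakk> \<Longrightarrow> \<beta> (glue (a, x)) = x"
  by (simp add: glue_def i_closed s_closed \<beta>_i \<beta>_s)

lemma glue_bij: "bij_betw glue (carrier H \<times> carrier K) (carrier G)"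
proof (rule bij_betw_imageI)
  show "inj_on glue (carrier H \<times> carrier K)"
  proof (rule inj_onI, clarify)
    fix a x b y
    assume c: "a \<in> carrier H" "x \<in> carrier K" "b \<in> carrier H" "y \<in> carrier K"
      and eq: "glue (a, x) = glue (b, y)"
    have xy: "x = y" using \<beta>_glue c eq by metis
    hence "i a = i b" using eq c by (simp add: glue_def i_closed s_closed)
    with xy show "a = b \<and> x = y" using c i_inj by (auto dest: inj_onD)
  qed
  show "glue ` (carrier H \<times> carrier K) = carrier G"
  proof
    show "glue ` (carrier H \<times> carrier K) \<subseteq> carrier G"
      by (auto simp: glue_def i_closed s_closed)
    show "carrier G \<subseteq> glue ` (carrier H \<times> carrier K)"
    proof
      fix g assume g: "g \<in> carrier G"
      have c: "\<beta> g \<in> carrier K" "s (\<beta> g) \<in> carrier G" using g by (auto simp: s_closed)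
      have "g \<otimes>\<^bsub>G\<^esub> inv\<^bsub>G\<^esub> s (\<beta> g) \<in> kernel G K \<beta>"
        using g c by (simp add: kernel_def \<beta>_s)
      then obtain a where a: "a \<in> carrier H" "g \<otimes>\<^bsub>G\<^esub> inv\<^bsub>G\<^esub> s (\<beta> g) = i a"
        unfolding exact[symmetric] by auto
      have "glue (a, \<beta> g) = g"
        using g c by (simp add: glue_def a(2)[symmetric] G.m_assoc)
      thus "g \<in> glue ` (carrier H \<times> carrier K)" using a c by force
    qed
  qed
qed

lemma glue_cases:
  assumes "g \<in> carrier G"
  obtains a x where "a \<in> carrier H" "x \<in> carrier K" "g = glue (a, x)"
  using assms bij_betw_imp_surj_on[OF glue_bij] by blast

lemma glue_mult:
  assumes "a \<in> carrier H" "b \<in> carrier H" "x \<in> carrier K" "y \<in> carrier K"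
  shows "glue (a, x) \<otimes>\<^bsub>G\<^esub> glue (b, y) = glue (a \<otimes>\<^bsub>H\<^esub> b, x \<otimes>\<^bsub>K\<^esub> y)"
proof -
  have "s x \<otimes>\<^bsub>G\<^esub> (i b \<otimes>\<^bsub>G\<^esub> s y) = i b \<otimes>\<^bsub>G\<^esub> (s x \<otimes>\<^bsub>G\<^esub> s y)"
    using assms by (simp add: G.m_assoc[symmetric] i_central[of b "s x"] i_closed s_closed)
  thus ?thesis
    using assms by (simp add: glue_def s_mult G.m_assoc i_closed s_closed)
qed

lemma glue_star:
  assumes a: "a \<in> carrier H" and b: "b \<in> carrier H" and x: "x \<in> carrier K" and y: "y \<in> carrier K"
  shows "glue (a, x) \<star>\<^bsub>G\<^esub> glue (b, y) = glue (\<Gamma> x b \<otimes>\<^bsub>H\<^esub> inv\<^bsub>H\<^esub> \<Gamma> y a, x \<star>\<^bsub>K\<^esub> y)"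
proof -
  note cl = i_closed s_closed G.star_closed K.star_closed \<Gamma>_closed
  have "glue (a, x) \<star>\<^bsub>G\<^esub> glue (b, y) =
      (s x \<star>\<^bsub>G\<^esub> (i b \<otimes>\<^bsub>G\<^esub> s y)) \<otimes>\<^bsub>G\<^esub> (i a \<star>\<^bsub>G\<^esub> (i b \<otimes>\<^bsub>G\<^esub> s y))"
    using assms by (simp add: glue_def G.star_mult_left conjugate_by_i cl)
  also have "s x \<star>\<^bsub>G\<^esub> (i b \<otimes>\<^bsub>G\<^esub> s y) = i (\<Gamma> x b) \<otimes>\<^bsub>G\<^esub> s (x \<star>\<^bsub>K\<^esub> y)"
    using assms by (simp add: G.star_mult_right conjugate_by_i cl i_\<Gamma> s_star)
  also have "i a \<star>\<^bsub>G\<^esub> (i b \<otimes>\<^bsub>G\<^esub> s y) = i (inv\<^bsub>H\<^esub> \<Gamma> y a)"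
    using assms by (simp add: G.star_mult_right conjugate_by_i cl star_trivial
        i_star[OF a s_closed[OF y]] i_\<Gamma>)
  finally have "glue (a, x) \<star>\<^bsub>G\<^esub> glue (b, y) =
      i (\<Gamma> x b) \<otimes>\<^bsub>G\<^esub> s (x \<star>\<^bsub>K\<^esub> y) \<otimes>\<^bsub>G\<^esub> i (inv\<^bsub>H\<^esub> \<Gamma> y a)" .
  also have "\<dots> = i (\<Gamma> x b) \<otimes>\<^bsub>G\<^esub> (i (inv\<^bsub>H\<^esub> \<Gamma> y a) \<otimes>\<^bsub>G\<^esub> s (x \<star>\<^bsub>K\<^esub> y))"
    using assms i_central[of "inv\<^bsub>H\<^esub> \<Gamma> y a" "s (x \<star>\<^bsub>K\<^esub> y)"]
    by (simp add: G.m_assoc cl del: i.hom_inv)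
  also have "\<dots> = glue (\<Gamma> x b \<otimes>\<^bsub>H\<^esub> inv\<^bsub>H\<^esub> \<Gamma> y a, x \<star>\<^bsub>K\<^esub> y)"
    using assms by (simp add: glue_def G.m_assoc cl del: i.hom_inv)
  finally show ?thesis .
qed

definition glue_map where
  "glue_map \<alpha> \<eta> =
    restrict (glue \<circ> map_prod \<alpha> \<eta> \<circ> the_inv_into (carrier H \<times> carrier K) glue) (carrier G)"

lemma glue_map_glue:
  assumes "a \<in> carrier H" "x \<in> carrier K"
  shows "glue_map \<alpha> \<eta> (glue (a, x)) = glue (\<alpha> a, \<eta> x)"
proof -
  have "glue (a, x) \<in> carrier G" using assms glue_bij by (auto simp: bij_betw_def)
  moreover have "the_inv_into (carrier H \<times> carrier K) glue (glue (a, x)) = (a, x)"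
    using assms glue_bij by (auto simp: bij_betw_def intro: the_inv_into_f_f)
  ultimately show ?thesis by (simp add: glue_map_def)
qed

lemma glue_map_bij:
  assumes "bij_betw \<alpha> (carrier H) (carrier H)" "bij_betw \<eta> (carrier K) (carrier K)"
  shows "bij_betw (glue_map \<alpha> \<eta>) (carrier G) (carrier G)"
proof -
  have "bij_betw (map_prod \<alpha> \<eta>) (carrier H \<times> carrier K) (carrier H \<times> carrier K)"
    by (rule bij_betw_map_prod) (fact assms)+
  hence "bij_betw (glue \<circ> map_prod \<alpha> \<eta> \<circ> the_inv_into (carrier H \<times> carrier K) glue)
      (carrier G) (carrier G)"
    by (intro bij_betw_trans[OF bij_betw_the_inv_into[OF glue_bij]] bij_betw_trans[OF _ glue_bij])
  thus ?thesis unfolding glue_map_def by (simp cong: bij_betw_cong)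
qed

lemma glue_map_auto:
  assumes \<alpha>: "\<alpha> \<in> mult_lie_auto H" and \<eta>: "\<eta> \<in> mult_lie_auto K"
    and comm: "\<And>x a. \<lbrakk>x \<in> carrier K; a \<in> carrier H\<rbrakk> \<Longrightarrow> \<alpha> (\<Gamma> x a) = \<Gamma> (\<eta> x) (\<alpha> a)"
  shows "glue_map \<alpha> \<eta> \<in> mult_lie_auto G"
proof -
  interpret a: group_hom H H \<alpha>
    using \<alpha> by unfold_locales (simp add: mult_lie_auto_def mult_lie_hom_def)
  note bij = glue_map_bij[OF mult_lie_auto_bij[OF \<alpha>] mult_lie_auto_bij[OF \<eta>]]
  have ops: "glue_map \<alpha> \<eta> (g \<otimes>\<^bsub>G\<^esub> h) = glue_map \<alpha> \<eta> g \<otimes>\<^bsub>G\<^esub> glue_map \<alpha> \<eta> h"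
    "glue_map \<alpha> \<eta> (g \<star>\<^bsub>G\<^esub> h) = glue_map \<alpha> \<eta> g \<star>\<^bsub>G\<^esub> glue_map \<alpha> \<eta> h"
    if "g \<in> carrier G" "h \<in> carrier G" for g h
  proof -
    obtain a x where ax: "a \<in> carrier H" "x \<in> carrier K" and g: "g = glue (a, x)"
      by (rule glue_cases[OF \<open>g \<in> carrier G\<close>])
    obtain b y where "b \<in> carrier H" "y \<in> carrier K" and h: "h = glue (b, y)"
      by (rule glue_cases[OF \<open>h \<in> carrier G\<close>])
    note c = ax this(1,2)
    note cl = c mult_lie_auto_closed[OF \<eta>] \<Gamma>_closed K.star_closed
    show "glue_map \<alpha> \<eta> (g \<otimes>\<^bsub>G\<^esub> h) = glue_map \<alpha> \<eta> g \<otimes>\<^bsub>G\<^esub> glue_map \<alpha> \<eta> h"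
      unfolding g h by (simp add: glue_mult glue_map_glue cl mult_lie_auto_mult[OF \<eta>])
    show "glue_map \<alpha> \<eta> (g \<star>\<^bsub>G\<^esub> h) = glue_map \<alpha> \<eta> g \<star>\<^bsub>G\<^esub> glue_map \<alpha> \<eta> h"
      unfolding g h by (simp add: glue_star glue_map_glue cl mult_lie_auto_star[OF \<eta>] comm)
  qed
  have "glue_map \<alpha> \<eta> \<in> extensional (carrier G)" by (simp add: glue_map_def)
  thus ?thesis
    using bij ops
    by (auto simp: mult_lie_auto_def mult_lie_hom_def auto_def Bij_def hom_def bij_betw_def)
qed

text \<open>The kernel and the image of \<open>s\<close> are the two coordinate axes \<open>(a, \<one>)\<close> and \<open>(\<one>, x)\<close>, which the
  glued map sends to themselves by \<open>\<alpha>\<close> and \<open>\<eta>\<close>.\<close>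

lemma inducible_if_commutes:
  assumes \<alpha>: "\<alpha> \<in> mult_lie_auto H" and \<eta>: "\<eta> \<in> mult_lie_auto K"
    and comm: "\<And>x a. \<lbrakk>x \<in> carrier K; a \<in> carrier H\<rbrakk> \<Longrightarrow> \<alpha> (\<Gamma> x a) = \<Gamma> (\<eta> x) (\<alpha> a)"
  shows "inducible H G K i \<beta> s \<alpha> \<eta>"
proof -
  interpret a: group_hom H H \<alpha>
    using \<alpha> by unfold_locales (simp add: mult_lie_auto_def mult_lie_hom_def)
  interpret e: group_hom K K \<eta>
    using \<eta> by unfold_locales (simp add: mult_lie_auto_def mult_lie_hom_def)
  have on_H: "glue_map \<alpha> \<eta> (i a) = i (\<alpha> a)" if "a \<in> carrier H" for a
    using glue_map_glue[OF that K.one_closed] that by (simp add: glue_def s_one i_closed)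
  have on_s: "\<beta> (glue_map \<alpha> \<eta> (s x)) = \<eta> x" if "x \<in> carrier K" for x
    using glue_map_glue[OF H.one_closed that] that by (simp add: glue_def s_closed \<beta>_s)
  have "glue_map \<alpha> \<eta> ` (i ` carrier H) = i ` (\<alpha> ` carrier H)"
    unfolding image_image by (intro image_cong refl on_H)
  also have "\<alpha> ` carrier H = carrier H"
    using mult_lie_auto_bij[OF \<alpha>] by (simp add: bij_betw_def)
  finally show ?thesis
    unfolding inducible_def 
    by (intro bexI[of _ "glue_map \<alpha> \<eta>"] conjI ballI on_H on_s glue_map_auto[OF assms])
qed

end

text \<open>Neither compatibility nor inducibility depends on the transversal, so \<open>t\<close> may be exchanged for
  a section that is a homomorphism.\<close>

theorem corollary3p8:
  fixes H :: "('h, 'l) mult_lie_scheme" and G :: "('g, 'm) mult_lie_scheme"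
    and K :: "('k, 'n) mult_lie_scheme"
    and i :: "'h \<Rightarrow> 'g" and \<beta> :: "'g \<Rightarrow> 'k" and t :: "'k \<Rightarrow> 'g"
    and \<alpha> :: "'h \<Rightarrow> 'h" and \<eta> :: "'k \<Rightarrow> 'k"
  assumes "center_extension H G K i \<beta>"
    and "splits G K \<beta>"
    and "transversal G K \<beta> t"
    and "\<alpha> \<in> mult_lie_auto H" and "\<eta> \<in> mult_lie_auto K"
    and "compatible H G K i t \<alpha> \<eta>"
  shows "inducible H G K i \<beta> t \<alpha> \<eta>"
proof -
  interpret center_extension H G K i \<beta> by fact
  obtain s where s: "transversal G K \<beta> s" "s \<in> mult_lie_hom K G"
    using assms(2) by (auto simp: splits_def)
  interpret split_center_extension H G K i \<beta> s by unfold_locales (fact s)+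
  have compat: "compatible H G K i s \<alpha> \<eta>"
    using compatible_independent[OF s(1) assms(3-5)] assms(6) by simp
  have "\<alpha> (\<Gamma> x a) = \<Gamma> (\<eta> x) (\<alpha> a)" if "x \<in> carrier K" "a \<in> carrier H" for x a
  proof -
    \<comment> \<open>Compatibility is stated for conjugates by \<open>\<alpha>\<close>; evaluating it at \<open>\<alpha> a\<close> clears the inverse.\<close>
    have "the_inv_into (carrier H) \<alpha> (\<alpha> a) = a"
      using mult_lie_auto_bij[OF assms(4)] that by (simp add: bij_betw_def the_inv_into_f_f)
    thus ?thesis
      using compat that mult_lie_auto_closed[OF assms(4)] by (metis compatible_def)
  qed
  hence "inducible H G K i \<beta> s \<alpha> \<eta>"
    by (rule inducible_if_commutes[OF assms(4,5)])
  thus ?thesis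
    using inducible_independent[OF s(1) assms(3,4)] by simp
qed

end
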